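(* Suppose $C=(c_{mn})_{m,n\ge0}$ is (the matrix of) a bounded, positive, self-adjoint operator on $\ell^2(\mathbb{N}_0)$, and $\mu$ is a nonnegative Borel measure on $[0,1)$ with $\mu\ll\lambda$ and $\frac{d\mu}{d\lambda}\in L^\infty(\lambda)$. Then $\mu\in\mathcal{M}(K_C)$ if and only if $C=CMC$, where $M=(M_{mn})_{m,n\ge0}$, $M_{mn}=\widehat{\mu}(n-m)$, is the Grammian matrix of $\{e_n\}_{n=0}^\infty\subset L^2(\mu)$, $e_n(x)=e^{2\pi i n x}$.
   Context: $\lambda$ is Lebesgue measure on $[0,1)$ (identified with the unit circle via $x\mapsto e^{2\pi i x}$); $\mathbb{D}$ is the open unit disc; $\mathbb{N}_0=\{0,1,2,\dots\}$; $\widehat{\mu}(n)=\int_0^1e^{-2\pi i nx}\,d\mu(x)$. For such $\mu$ the matrix $M$ is a bounded operator on $\ell^2(\mathbb{N}_0)$, so $CMC$ is a product of bounded operators. $K_C(w,z)=\sum_n\sum_m c_{mn}\overline{w}^m z^n$ for $w,z\in\mathbb{D}$. For a finite Borel measure $\mu$ on $[0,1)$ and an analytic function $f$ on $\mathbb{D}$, an $L^2(\mu)$-boundary of $f$ is a function $f^\star\in L^2(\mu)$ with $\lim_{r\to1^-}\|f^\star(x)-f(re^{2\pi i x})\|_{L^2(\mu)}=0$ (unique if it exists). For a positive matrix (positive semidefinite kernel) $K$ on $\mathbb{D}$, $\mathcal{M}(K)$ is the set of nonnegative finite Borel measures $\mu$ on $[0,1)$ such that for each $w\in\mathbb{D}$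 the function $K(w,\cdot)$ possesses an $L^2(\mu)$-boundary $K^\star(w,\cdot)$, and $K(w,z)=\int_0^1K^\star(w,x)\overline{K^\star(z,x)}\,d\mu(x)$ for all $w,z\in\mathbb{D}$. *)

theory Defs
  imports "HOL-Probability.Probability" "HOL-Complex_Analysis.Complex_Analysis"
begin

section \<open>The complex Hilbert space of square-summable sequences\<close>

lemma square_summable_add:
  fixes x y :: "nat \<Rightarrow> complex"
  assumes "summable (\<lambda>n. (cmod (x n))\<^sup>2)" "summable (\<lambda>n. (cmod (y n))\<^sup>2)"
  shows "summable (\<lambda>n. (cmod (x n + y n))\<^sup>2)"
proof (rule summable_comparison_test')
  show "summable (\<lambda>n. 2 * (cmod (x n))\<^sup>2 + 2 * (cmod (y n))\<^sup>2)"
    using assms by (intro summable_add summable_mult)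
  show "norm ((cmod (x n + y n))\<^sup>2) \<le> 2 * (cmod (x n))\<^sup>2 + 2 * (cmod (y n))\<^sup>2" for n
  proof -
    have "(cmod (x n + y n))\<^sup>2 \<le> (cmod (x n) + cmod (y n))\<^sup>2"
      by (intro power_mono norm_triangle_ineq) auto
    also have "\<dots> \<le> 2 * (cmod (x n))\<^sup>2 + 2 * (cmod (y n))\<^sup>2"
      using sum_squares_bound[of "cmod (x n)" "cmod (y n)"] by (simp add: power2_sum)
    finally show ?thesis by simp
  qed
qed

lemma square_summable_scale:
  fixes x :: "nat \<Rightarrow> complex"
  assumes "summable (\<lambda>n. (cmod (x n))\<^sup>2)"
  shows "summable (\<lambda>n. (cmod (c * x n))\<^sup>2)"
  using summable_mult[OF assms, of "(cmod c)\<^sup>2"] by (simp add: norm_mult power_mult_distrib)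

typedef ell2 = "{x :: nat \<Rightarrow> complex. summable (\<lambda>n. (cmod (x n))\<^sup>2)}"
  morphisms coord Abs_ell2
  by (rule exI[of _ "\<lambda>_. 0"]) simp

setup_lifting type_definition_ell2

lift_definition scaleC :: "complex \<Rightarrow> ell2 \<Rightarrow> ell2" (infixr \<open>*\<^sub>C\<close> 75)
  is "\<lambda>c x n. c * x n"
  by (rule square_summable_scale)

lift_definition cinner :: "ell2 \<Rightarrow> ell2 \<Rightarrow> complex"
  is "\<lambda>x y. \<Sum>n. x n * cnj (y n)" .

lift_definition ell2_basis :: "nat \<Rightarrow> ell2"
  is "\<lambda>k n. if n = k then 1 else 0"
proof -
  fix k :: nat
  show "summable (\<lambda>n. (cmod (if n = k then 1 else 0))\<^sup>2)"
    by (rule summable_finite[of "{k}"]) auto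
qed

lemma summable_coord: "summable (\<lambda>n. (cmod (coord x n))\<^sup>2)"
  using coord[of x] by simp

lemma summable_cinner: "summable (\<lambda>n. coord x n * cnj (coord y n))"
proof (rule summable_comparison_test')
  show "summable (\<lambda>n. (cmod (coord x n))\<^sup>2 + (cmod (coord y n))\<^sup>2)"
    by (intro summable_add summable_coord)
  show "norm (coord x n * cnj (coord y n)) \<le> (cmod (coord x n))\<^sup>2 + (cmod (coord y n))\<^sup>2" for n
  proof -
    have "2 * (cmod (coord x n) * cmod (coord y n)) \<le> (cmod (coord x n))\<^sup>2 + (cmod (coord y n))\<^sup>2"
      using sum_squares_bound[of "cmod (coord x n)" "cmod (coord y n)"] by simp
    moreover have "0 \<le> cmod (coord x n) * cmod (coord y n)" by simp
    ultimately show ?thesis unfolding norm_mult complex_mod_cnj by linarith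
  qed
qed

instantiation ell2 :: real_inner
begin

lift_definition zero_ell2 :: ell2 is "\<lambda>_. 0" by simp

lift_definition plus_ell2 :: "ell2 \<Rightarrow> ell2 \<Rightarrow> ell2" is "\<lambda>x y n. x n + y n"
  by (rule square_summable_add)

lift_definition uminus_ell2 :: "ell2 \<Rightarrow> ell2" is "\<lambda>x n. - x n" by simp

lift_definition minus_ell2 :: "ell2 \<Rightarrow> ell2 \<Rightarrow> ell2" is "\<lambda>x y n. x n - y n"
  using square_summable_add[of _ "\<lambda>n. - y n" for y] by fastforce

lift_definition scaleR_ell2 :: "real \<Rightarrow> ell2 \<Rightarrow> ell2" is "\<lambda>r x n. r *\<^sub>R x n"
  using square_summable_scale[of _ "of_real r" for r] by (simp add: scaleR_conv_of_real)

lift_definition norm_ell2 :: "ell2 \<Rightarrow> real" is "\<lambda>x. sqrt (\<Sum>n. (cmod (x n))\<^sup>2)" .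

definition inner_ell2 :: "ell2 \<Rightarrow> ell2 \<Rightarrow> real" where
  "inner_ell2 x y = Re (cinner x y)"

definition sgn_ell2 :: "ell2 \<Rightarrow> ell2" where
  "sgn_ell2 x = inverse (norm x) *\<^sub>R x"

definition dist_ell2 :: "ell2 \<Rightarrow> ell2 \<Rightarrow> real" where
  "dist_ell2 x y = norm (x - y)"

definition uniformity_ell2 :: "(ell2 \<times> ell2) filter" where
  "uniformity_ell2 = (INF e\<in>{0<..}. principal {(x, y). dist x y < e})"

definition open_ell2 :: "ell2 set \<Rightarrow> bool" where
  "open_ell2 U \<longleftrightarrow> (\<forall>x\<in>U. \<forall>\<^sub>F (x', y) in uniformity. x' = x \<longrightarrow> y \<in> U)"

lemma inner_ell2_series: "inner x y = (\<Sum>n. Re (coord x n * cnj (coord y n)))" for x y :: ell2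
  unfolding inner_ell2_def cinner.rep_eq by (rule Re_suminf[OF summable_cinner])

lemma inner_ell2_self: "inner x x = (\<Sum>n. (cmod (coord x n))\<^sup>2)" for x :: ell2
  unfolding inner_ell2_series by (simp add: cmod_def power2_eq_square[symmetric])

instance
proof
  fix x y z :: ell2 and a b r :: real
  show "x + y + z = x + (y + z)" "x + y = y + x" "0 + x = x" "- x + x = 0" "x - y = x + - y"
    "a *\<^sub>R (x + y) = a *\<^sub>R x + a *\<^sub>R y" "(a + b) *\<^sub>R x = a *\<^sub>R x + b *\<^sub>R x"
    "a *\<^sub>R b *\<^sub>R x = (a * b) *\<^sub>R x" "1 *\<^sub>R x = x"
    by (transfer; force simp: algebra_simps)+
  show "sgn x = inverse (norm x) *\<^sub>R x" by (rule sgn_ell2_def)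
  show "dist x y = norm (x - y)" by (rule dist_ell2_def)
  show "(uniformity :: (ell2 \<times> ell2) filter) = (INF e\<in>{0<..}. principal {(x, y). dist x y < e})"
    by (rule uniformity_ell2_def)
  show "open U \<longleftrightarrow> (\<forall>x\<in>U. \<forall>\<^sub>F (x', y) in uniformity. x' = x \<longrightarrow> y \<in> U)" for U :: "ell2 set"
    by (rule open_ell2_def)
  show "inner x y = inner y x"
    by (simp add: inner_ell2_series mult.commute)
  have s: "summable (\<lambda>n. Re (coord u n * cnj (coord v n)))" for u v
    by (rule summable_Re[OF summable_cinner])
  show "inner (x + y) z = inner x z + inner y z"
    unfolding inner_ell2_series suminf_add[OF s s]
    by (simp add: plus_ell2.rep_eq algebra_simps)
  show "inner (r *\<^sub>R x) y = r * inner x y"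
    unfolding inner_ell2_series suminf_mult[OF s, symmetric]
    by (simp add: scaleR_ell2.rep_eq algebra_simps)
  show "0 \<le> inner x x"
    unfolding inner_ell2_self by (intro suminf_nonneg summable_coord) simp
  show "inner x x = 0 \<longleftrightarrow> x = 0"
    unfolding inner_ell2_self by (subst suminf_eq_zero_iff[OF summable_coord])
      (auto simp: zero_ell2.rep_eq coord_inject[symmetric])
  show "norm x = sqrt (inner x x)"
    by (simp add: inner_ell2_self norm_ell2.rep_eq)
qed

end

section \<open>Bounded operators and their matrices\<close>

definition bounded_clinear :: "(ell2 \<Rightarrow> ell2) \<Rightarrow> bool" where
  "bounded_clinear T \<longleftrightarrow> bounded_linear T \<and> (\<forall>c x. T (c *\<^sub>C x) = c *\<^sub>C T x)"

definition self_adjoint :: "(ell2 \<Rightarrow> ell2) \<Rightarrow> bool" where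
  "self_adjoint T \<longleftrightarrow> (\<forall>x y. cinner (T x) y = cinner x (T y))"

definition positive_operator :: "(ell2 \<Rightarrow> ell2) \<Rightarrow> bool" where
  "positive_operator T \<longleftrightarrow> (\<forall>x. cinner (T x) x \<in> \<real>\<^sub>\<ge>\<^sub>0)"

(* First index: row.  Since cinner is linear in its first argument, the entry (m, n) is the m-th
   coordinate of the image of the n-th basis vector. *)
definition matrix_of :: "(ell2 \<Rightarrow> ell2) \<Rightarrow> nat \<Rightarrow> nat \<Rightarrow> complex" where
  "matrix_of T m n = cinner (T (ell2_basis n)) (ell2_basis m)"

lemma cinner_basis: "cinner x (ell2_basis m) = coord x m"
proof -
  have "(\<Sum>n. coord x n * cnj (coord (ell2_basis m) n)) = (\<Sum>n. if n = m then coord x n else 0)"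
    by (intro suminf_cong) (simp add: ell2_basis.rep_eq)
  also have "\<dots> = (\<Sum>n\<in>{m}. if n = m then coord x n else 0)"
    by (rule suminf_finite) auto
  finally show ?thesis by (simp add: cinner.rep_eq)
qed

lemma coord_basis_sum:
  "coord (\<Sum>n<N. coord x n *\<^sub>C ell2_basis n) k = (if k < N then coord x k else 0)"
  by (induction N)
    (auto simp: zero_ell2.rep_eq plus_ell2.rep_eq scaleC.rep_eq ell2_basis.rep_eq less_Suc_eq)

lemma basis_expansion: "(\<lambda>N. \<Sum>n<N. coord x n *\<^sub>C ell2_basis n) \<longlonglongrightarrow> x"
proof -
  define s where "s N = (\<Sum>n<N. coord x n *\<^sub>C ell2_basis n)" for N
  have "norm (s N - x) = sqrt (\<Sum>n. (cmod (coord x (n + N)))\<^sup>2)" for N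
  proof -
    have c: "coord (s N - x) n = (if n < N then 0 else - coord x n)" for n
      by (simp add: s_def minus_ell2.rep_eq coord_basis_sum)
    show ?thesis
      unfolding norm_ell2.rep_eq
      by (subst suminf_split_initial_segment[OF summable_coord, of _ N]) (simp add: c)
  qed
  moreover have "(\<lambda>N. sqrt (\<Sum>n. (cmod (coord x (n + N)))\<^sup>2)) \<longlonglongrightarrow> 0"
    using tendsto_real_sqrt[OF suminf_exist_split2[OF summable_coord[of x]]] by simp
  ultimately have "(\<lambda>N. norm (s N - x)) \<longlonglongrightarrow> 0" by simp
  then show ?thesis
    unfolding s_def[symmetric] by (simp add: tendsto_norm_zero_iff LIM_zero_iff)
qed

lemma matrix_of_inject:
  assumes S: "bounded_clinear S" and T: "bounded_clinear T" and eq: "matrix_of S = matrix_of T"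
  shows "S = T"
proof
  fix x
  have bl: "bounded_linear S" "bounded_linear T"
    and sc: "\<And>c x. S (c *\<^sub>C x) = c *\<^sub>C S x" "\<And>c x. T (c *\<^sub>C x) = c *\<^sub>C T x"
    using S T by (auto simp: bounded_clinear_def)
  have "coord (S (ell2_basis n)) m = coord (T (ell2_basis n)) m" for m n
    using fun_cong[OF fun_cong[OF eq, of m], of n] by (simp add: matrix_of_def cinner_basis)
  then have b: "S (ell2_basis n) = T (ell2_basis n)" for n
    by (simp add: coord_inject[symmetric] fun_eq_iff)
  let ?s = "\<lambda>N. \<Sum>n<N. coord x n *\<^sub>C ell2_basis n"
  have "S (?s N) = T (?s N)" for N
    by (simp add: linear_sum[OF bounded_linear.linear[OF bl(1)]]
        linear_sum[OF bounded_linear.linear[OF bl(2)]] sc b)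
  moreover have "(\<lambda>N. S (?s N)) \<longlonglongrightarrow> S x" "(\<lambda>N. T (?s N)) \<longlonglongrightarrow> T x"
    by (intro bounded_linear.tendsto[OF bl(1)] bounded_linear.tendsto[OF bl(2)] basis_expansion)+
  ultimately show "S x = T x" by (auto intro: LIMSEQ_unique)
qed

section \<open>Measures on the circle\<close>

definition unit_lebesgue :: "real measure" where
  "unit_lebesgue = restrict_space lborel {0..<1}"

definition fourier_coeff :: "real measure \<Rightarrow> int \<Rightarrow> complex" where
  "fourier_coeff \<mu> n = (\<integral>x. exp (- (2 * of_real pi * \<i> * of_int n * of_real x)) \<partial>\<mu>)"

definition gram_matrix :: "real measure \<Rightarrow> nat \<Rightarrow> nat \<Rightarrow> complex" where
  "gram_matrix \<mu> m n = fourier_coeff \<mu> (int n - int m)"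

definition kernel_of_matrix :: "(nat \<Rightarrow> nat \<Rightarrow> complex) \<Rightarrow> complex \<Rightarrow> complex \<Rightarrow> complex" where
  "kernel_of_matrix c w z = (\<Sum>n. \<Sum>m. c m n * cnj w ^ m * z ^ n)"

definition square_integrable :: "real measure \<Rightarrow> (real \<Rightarrow> complex) \<Rightarrow> bool" where
  "square_integrable \<mu> g \<longleftrightarrow>
     g \<in> borel_measurable \<mu> \<and> integrable \<mu> (\<lambda>x. (cmod (g x))\<^sup>2)"

(* The squared distance is taken as an ennreal-valued integral: the Bochner integral of a
   non-integrable function is 0 by convention and would give spurious convergence. *)
definition L2_boundary ::
    "real measure \<Rightarrow> (complex \<Rightarrow> complex) \<Rightarrow> (real \<Rightarrow> complex) \<Rightarrow> bool" where
  "L2_boundary \<mu> f g \<longleftrightarrow>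
     f holomorphic_on ball 0 1 \<and> square_integrable \<mu> g \<and>
     ((\<lambda>r. \<integral>\<^sup>+x. ennreal ((cmod (g x - f (of_real r * exp (2 * of_real pi * \<i> * of_real x))))\<^sup>2) \<partial>\<mu>)
        \<longlongrightarrow> 0) (at_left (1::real))"

definition boundary_measures :: "(complex \<Rightarrow> complex \<Rightarrow> complex) \<Rightarrow> real measure set" where
  "boundary_measures K =
     {\<mu>. sets \<mu> = sets unit_lebesgue \<and> finite_measure \<mu> \<and>
       (\<exists>Kb. (\<forall>w\<in>ball 0 1. L2_boundary \<mu> (K w) (Kb w)) \<and>
             (\<forall>w\<in>ball 0 1. \<forall>z\<in>ball 0 1. K w z = (\<integral>x. Kb w x * cnj (Kb z x) \<partial>\<mu>)))}"

end

(* Write k_w for the sequence (w^n). For self-adjoint C the kernel K_C(w,.) is the power series with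
   coefficients the conjugates of C k_w, and K_C(w,z) = <C k_z, k_w>. Since the density of mu is
   bounded, the conjugate modes e_n^* form a Bessel sequence in L^2(mu), so that the synthesis map
   V x = sum x_n e_n^* is bounded from l^2 to L^2(mu) and M = V^* V is a bounded operator. By Abel
   summation the boundary of K_C(w,.) exists and is the conjugate of V C k_w; boundaries are unique
   up to null sets. Hence the integral of K^*(w,.) against the conjugate of K^*(z,.) equals
   <M C k_z, C k_w> = <C M C k_z, k_w>, and the reproducing identity says that C and CMC have
   the same sesquilinear form on the vectors k_w, which are total by uniqueness of power series. *)
theory Submission
  imports Defs
begin

section \<open>Mean-square convergence\<close>

text \<open>The squared norm takes values in \<open>ennreal\<close>, as in
  \<open>L2_boundary\<close>, so bounds and limits can be stated before any integrability is
  known.\<close>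

definition l2sq :: "'a measure \<Rightarrow> ('a \<Rightarrow> complex) \<Rightarrow> ennreal" where
  "l2sq M f = (\<integral>\<^sup>+x. ennreal ((cmod (f x))\<^sup>2) \<partial>M)"

lemma tendsto_ennreal_0_le:
  fixes f g :: "'b \<Rightarrow> ennreal"
  assumes "(g \<longlongrightarrow> 0) F" "\<And>r. f r \<le> g r"
  shows "(f \<longlongrightarrow> 0) F"
  by (rule tendsto_sandwich[OF _ _ tendsto_const assms(1)]) (auto simp: assms(2))

lemma l2sq_cong_AE: "AE x in M. f x = g x \<Longrightarrow> l2sq M f = l2sq M g"
  unfolding l2sq_def by (rule nn_integral_cong_AE) auto

lemma l2sq_minus_commute: "l2sq M (\<lambda>x. f x - g x) = l2sq M (\<lambda>x. g x - f x)"
  by (simp add: l2sq_def norm_minus_commute)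

lemma l2sq_cnj: "l2sq M (\<lambda>x. cnj (f x)) = l2sq M f"
  by (simp add: l2sq_def)

lemma l2sq_scale:
  assumes [measurable]: "f \<in> borel_measurable M"
  shows "l2sq M (\<lambda>x. c * f x) = ennreal ((cmod c)\<^sup>2) * l2sq M f"
  unfolding l2sq_def
  by (simp add: norm_mult power_mult_distrib ennreal_mult nn_integral_cmult)

text \<open>The pointwise bound |a + b|^2 \<le> 2 |a|^2 + 2 |b|^2 stands in for Minkowski's
  inequality. The factor 2 is harmless, since only boundedness and convergence to 0 are at
  stake.\<close>

lemma l2sq_add:
  assumes [measurable]: "f \<in> borel_measurable M" "g \<in> borel_measurable M"
  shows "l2sq M (\<lambda>x. f x + g x) \<le> 2 * l2sq M f + 2 * l2sq M g"
proof -
  have le: "(cmod (a + b))\<^sup>2 \<le> 2 * (cmod a)\<^sup>2 + 2 * (cmod b)\<^sup>2" for a b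
  proof -
    have "(cmod (a + b))\<^sup>2 \<le> (cmod a + cmod b)\<^sup>2"
      by (intro power_mono norm_triangle_ineq) auto
    also have "\<dots> \<le> 2 * (cmod a)\<^sup>2 + 2 * (cmod b)\<^sup>2"
      using sum_squares_bound[of "cmod a" "cmod b"] by (simp add: power2_sum)
    finally show ?thesis .
  qed
  have "ennreal ((cmod (f x + g x))\<^sup>2)
      \<le> 2 * ennreal ((cmod (f x))\<^sup>2) + 2 * ennreal ((cmod (g x))\<^sup>2)" for x
    using ennreal_leI[OF le[of "f x" "g x"]] by (simp add: ennreal_plus ennreal_mult)
  then have "l2sq M (\<lambda>x. f x + g x)
      \<le> (\<integral>\<^sup>+x. 2 * ennreal ((cmod (f x))\<^sup>2) + 2 * ennreal ((cmod (g x))\<^sup>2) \<partial>M)"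
    unfolding l2sq_def by (intro nn_integral_mono)
  also have "\<dots> = 2 * l2sq M f + 2 * l2sq M g"
    unfolding l2sq_def by (simp add: nn_integral_add nn_integral_cmult)
  finally show ?thesis .
qed

lemma l2sq_triangle:
  assumes [measurable]: "f \<in> borel_measurable M" "g \<in> borel_measurable M" "h \<in> borel_measurable M"
  shows "l2sq M (\<lambda>x. f x - h x) \<le> 2 * l2sq M (\<lambda>x. f x - g x) + 2 * l2sq M (\<lambda>x. g x - h x)"
  using l2sq_add[of "\<lambda>x. f x - g x" M "\<lambda>x. g x - h x"] by simp

lemma l2sq_eq_0_AE:
  assumes [measurable]: "f \<in> borel_measurable M" and "l2sq M f = 0"
  shows "AE x in M. f x = 0"
  using assms(2) unfolding l2sq_def by (subst (asm) nn_integral_0_iff_AE) auto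

lemma square_integrable_iff:
  "square_integrable \<mu> g \<longleftrightarrow> g \<in> borel_measurable \<mu> \<and> l2sq \<mu> g < \<infinity>"
  unfolding square_integrable_def l2sq_def by (auto simp: integrable_iff_bounded)

text \<open>The filter is arbitrary so that the lemma serves both sequences of partial sums and
  radial limits r -> 1-.\<close>

lemma l2sq_tendsto_unique:
  assumes F: "F \<noteq> bot"
    and [measurable]: "g \<in> borel_measurable M" "h \<in> borel_measurable M"
    and s: "\<forall>\<^sub>F r in F. s r \<in> borel_measurable M"
    and g: "((\<lambda>r. l2sq M (\<lambda>x. g x - s r x)) \<longlongrightarrow> 0) F"
    and h: "((\<lambda>r. l2sq M (\<lambda>x. h x - s r x)) \<longlongrightarrow> 0) F"
  shows "AE x in M. g x = h x"
proof -
  have "((\<lambda>r. 2 * l2sq M (\<lambda>x. g x - s r x) + 2 * l2sq M (\<lambda>x. h x - s r x))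
      \<longlongrightarrow> 2 * 0 + 2 * 0) F"
    by (intro tendsto_add ennreal_tendsto_cmult g h) auto
  moreover have "\<forall>\<^sub>F r in F. l2sq M (\<lambda>x. g x - h x)
      \<le> 2 * l2sq M (\<lambda>x. g x - s r x) + 2 * l2sq M (\<lambda>x. h x - s r x)"
    using s
  proof eventually_elim
    case (elim r)
    then show ?case
      using l2sq_triangle[of g M "s r" h] l2sq_minus_commute[of M h "s r"] by simp
  qed
  ultimately have "l2sq M (\<lambda>x. g x - h x) \<le> 2 * 0 + 2 * 0"
    using tendsto_lowerbound F by blast
  then have "AE x in M. g x - h x = 0"
    by (intro l2sq_eq_0_AE) auto
  then show ?thesis by simp
qed

section \<open>Inner products of square-integrable functions and completeness\<close>

lemma borel_measurable_cnj [measurable]: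
  "f \<in> borel_measurable M \<Longrightarrow> (\<lambda>x. cnj (f x)) \<in> borel_measurable M"
  by (rule borel_measurable_continuous_on[of cnj]) (intro continuous_intros)

lemma integrable_mult_cnj:
  assumes [measurable]: "f \<in> borel_measurable M" "g \<in> borel_measurable M"
    and "l2sq M f < \<infinity>" "l2sq M g < \<infinity>"
  shows "integrable M (\<lambda>x. f x * cnj (g x))"
proof -
  have "(\<integral>\<^sup>+x. ennreal (cmod (f x)) * ennreal (cmod (g x)) \<partial>M)\<^sup>2 \<le> l2sq M f * l2sq M g"
    using Cauchy_Schwarz_nn_integral[of "\<lambda>x. ennreal (cmod (f x))" M "\<lambda>x. ennreal (cmod (g x))"]
    by (simp add: l2sq_def ennreal_power)
  also have "\<dots> < \<infinity>" using assms by (simp add: ennreal_mult_less_top)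
  finally show ?thesis
    by (intro integrableI_bounded) (auto simp: norm_mult ennreal_mult power_less_top_ennreal)
qed

text \<open>No integrability has to be assumed: if the product is not integrable, its Bochner
  integral is 0 by convention and the bound is trivial.\<close>

lemma Cauchy_Schwarz_l2sq:
  assumes [measurable]: "f \<in> borel_measurable M" "g \<in> borel_measurable M"
  shows "ennreal ((cmod (\<integral>x. f x * cnj (g x) \<partial>M))\<^sup>2) \<le> l2sq M f * l2sq M g"
proof -
  have "ennreal (cmod (\<integral>x. f x * cnj (g x) \<partial>M))
      \<le> (\<integral>\<^sup>+x. ennreal (cmod (f x)) * ennreal (cmod (g x)) \<partial>M)"
  proof (cases "integrable M (\<lambda>x. f x * cnj (g x))")
    case True
    then show ?thesis
      using integral_norm_bound_ennreal[OF True] by (simp add: norm_mult ennreal_mult)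
  qed (simp add: not_integrable_integral_eq)
  then have "(ennreal (cmod (\<integral>x. f x * cnj (g x) \<partial>M)))\<^sup>2
      \<le> (\<integral>\<^sup>+x. ennreal (cmod (f x)) * ennreal (cmod (g x)) \<partial>M)\<^sup>2"
    by (rule power_mono) simp
  also have "\<dots> \<le> l2sq M f * l2sq M g"
    using Cauchy_Schwarz_nn_integral[of "\<lambda>x. ennreal (cmod (f x))" M "\<lambda>x. ennreal (cmod (g x))"]
    by (simp add: l2sq_def ennreal_power)
  finally show ?thesis by (simp add: ennreal_power)
qed

lemma integral_mult_cnj_tendsto:
  assumes [measurable]: "g \<in> borel_measurable M" "f \<in> borel_measurable M"
      "\<And>n. s n \<in> borel_measurable M"
    and g: "l2sq M g < \<infinity>" and f: "l2sq M f < \<infinity>" and sn: "\<And>n. l2sq M (s n) < \<infinity>"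
    and lim: "(\<lambda>n. l2sq M (\<lambda>x. f x - s n x)) \<longlonglongrightarrow> 0"
  shows "(\<lambda>n. \<integral>x. g x * cnj (s n x) \<partial>M) \<longlonglongrightarrow> (\<integral>x. g x * cnj (f x) \<partial>M)"
proof -
  let ?d = "\<lambda>n. (\<integral>x. g x * cnj (f x) \<partial>M) - (\<integral>x. g x * cnj (s n x) \<partial>M)"
  have le: "ennreal ((cmod (?d n))\<^sup>2) \<le> l2sq M g * l2sq M (\<lambda>x. f x - s n x)" for n
  proof -
    have "?d n = (\<integral>x. g x * cnj (f x - s n x) \<partial>M)"
      using integrable_mult_cnj[of g M f] integrable_mult_cnj[of g M "s n"] g f sn
      by (subst Bochner_Integration.integral_diff[symmetric]) (auto simp: algebra_simps)
    then show ?thesis using Cauchy_Schwarz_l2sq[of g M "\<lambda>x. f x - s n x"] by simp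
  qed
  \<comment> \<open>Finiteness of \<open>l2sq M g\<close> matters here: multiplication by an
    infinite constant is not continuous at 0 in \<open>ennreal\<close>.\<close>
  have "(\<lambda>n. l2sq M g * l2sq M (\<lambda>x. f x - s n x)) \<longlonglongrightarrow> l2sq M g * 0"
    using g by (intro ennreal_tendsto_cmult lim) auto
  then have "(\<lambda>n. ennreal ((cmod (?d n))\<^sup>2)) \<longlonglongrightarrow> 0"
    using tendsto_ennreal_0_le[OF _ le] by simp
  then have "(\<lambda>n. ennreal ((cmod (?d n))\<^sup>2)) \<longlonglongrightarrow> ennreal 0" by simp
  then have "(\<lambda>n. (cmod (?d n))\<^sup>2) \<longlonglongrightarrow> 0"
    by (subst (asm) tendsto_ennreal_iff) auto
  then have "(\<lambda>n. sqrt ((cmod (?d n))\<^sup>2)) \<longlonglongrightarrow> sqrt 0" by (rule tendsto_real_sqrt)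
  then have "?d \<longlonglongrightarrow> 0" by (simp add: tendsto_norm_zero_iff)
  then show ?thesis
    using tendsto_diff[OF tendsto_const, of ?d 0 sequentially "\<integral>x. g x * cnj (f x) \<partial>M"] by simp
qed

text \<open>The measure being finite, a mean-square Cauchy sequence is Cauchy in \<open>L\<^sup>1\<close>, so it has an almost
  everywhere convergent subsequence, whose limit is the mean-square limit by Fatou's lemma.\<close>

lemma (in finite_measure) l2sq_Cauchy_convergent:
  fixes s :: "nat \<Rightarrow> 'a \<Rightarrow> complex"
  assumes [measurable]: "\<And>n. s n \<in> borel_measurable M" and fin: "\<And>n. l2sq M (s n) < \<infinity>"
    and cau: "\<And>e. e > 0 \<Longrightarrow> \<exists>N. \<forall>i\<ge>N. \<forall>j\<ge>N. l2sq M (\<lambda>x. s i x - s j x) < ennreal e"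
  shows "\<exists>g\<in>borel_measurable M. (\<lambda>n. l2sq M (\<lambda>x. g x - s n x)) \<longlonglongrightarrow> 0"
proof -
  define m where "m = measure M (space M)"
  have one: "l2sq M (\<lambda>_. 1) = ennreal m"
    by (simp add: l2sq_def m_def emeasure_eq_measure)
  have int: "integrable M (s n)" for n
    using integrable_mult_cnj[of "s n" M "\<lambda>_. 1"] fin one by simp
  have L1: "\<exists>N. \<forall>i\<ge>N. \<forall>j\<ge>N. LINT x|M. norm (s i x - s j x) < e" if e: "e > 0" for e
  proof -
    \<comment> \<open>Dividing by \<open>m + 1\<close> instead of \<open>m\<close> covers the null
      measure and makes the final estimate strict, as m / (m + 1) < 1.\<close>
    have "e\<^sup>2 / (m + 1) > 0" using e by (simp add: m_def add_nonneg_pos)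
    from cau[OF this] obtain N where N: "\<And>i j. i \<ge> N \<Longrightarrow> j \<ge> N
        \<Longrightarrow> l2sq M (\<lambda>x. s i x - s j x) < ennreal (e\<^sup>2 / (m + 1))" by blast
    have "LINT x|M. norm (s i x - s j x) < e" if "i \<ge> N" "j \<ge> N" for i j
    proof -
      \<comment> \<open>Cauchy-Schwarz against the constant 1 turns the mean-square bound into an
        L^1 bound. The modulus is cast to a complex function to fit \<open>l2sq\<close>.\<close>
      let ?h = "\<lambda>x. complex_of_real (cmod (s i x - s j x))"
      have h: "l2sq M ?h = l2sq M (\<lambda>x. s i x - s j x)" by (simp add: l2sq_def)
      have "ennreal ((cmod (\<integral>x. ?h x * cnj 1 \<partial>M))\<^sup>2) \<le> l2sq M ?h * ennreal m"
        using Cauchy_Schwarz_l2sq[of ?h M "\<lambda>_. 1"] one by simp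
      also have "\<dots> \<le> ennreal (e\<^sup>2 / (m + 1)) * ennreal m"
        unfolding h using N[OF that] by (intro mult_right_mono) auto
      also have "\<dots> = ennreal (e\<^sup>2 / (m + 1) * m)"
        by (subst ennreal_mult) (auto simp: m_def)
      finally have "(cmod (\<integral>x. ?h x * cnj 1 \<partial>M))\<^sup>2 \<le> e\<^sup>2 / (m + 1) * m"
        by (subst (asm) ennreal_le_iff) (auto simp: m_def)
      also have "\<dots> < e\<^sup>2"
      proof -
        have "m \<ge> 0" by (simp add: m_def)
        then show ?thesis using e by (simp add: field_simps)
      qed
      finally have "cmod (\<integral>x. ?h x * cnj 1 \<partial>M) < e"
        using e by (simp add: power_less_imp_less_base)
      then show ?thesis by simp
    qed
    then show ?thesis by blast
  qed
  obtain r where r: "strict_mono r" and C: "AE x in M. Cauchy (\<lambda>i. s (r i) x)"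
    using cauchy_L1_AE_cauchy_subseq[OF int L1] by metis
  define g where "g x = lim (\<lambda>i. s (r i) x)" for x
  have [measurable]: "g \<in> borel_measurable M" unfolding g_def by measurable
  have lim: "AE x in M. (\<lambda>i. s (r i) x) \<longlonglongrightarrow> g x"
    using C by eventually_elim (auto simp: g_def Cauchy_convergent_iff convergent_LIMSEQ_iff)
  have fatou: "l2sq M (\<lambda>x. g x - s n x) \<le> liminf (\<lambda>i. l2sq M (\<lambda>x. s (r i) x - s n x))" for n
  proof -
    have "l2sq M (\<lambda>x. g x - s n x) = (\<integral>\<^sup>+x. liminf (\<lambda>i. ennreal ((cmod (s (r i) x - s n x))\<^sup>2)) \<partial>M)"
      unfolding l2sq_def
    proof (rule nn_integral_cong_AE)
      show "AE x in M. ennreal ((cmod (g x - s n x))\<^sup>2)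
          = liminf (\<lambda>i. ennreal ((cmod (s (r i) x - s n x))\<^sup>2))"
        using lim
      proof eventually_elim
        case (elim x)
        have "(\<lambda>i. ennreal ((cmod (s (r i) x - s n x))\<^sup>2)) \<longlonglongrightarrow> ennreal ((cmod (g x - s n x))\<^sup>2)"
          by (intro tendsto_intros elim) 
        then show ?case by (intro lim_imp_Liminf[symmetric]) auto
      qed
    qed
    also have "\<dots> \<le> liminf (\<lambda>i. l2sq M (\<lambda>x. s (r i) x - s n x))"
      unfolding l2sq_def by (rule nn_integral_liminf) measurable
    finally show ?thesis .
  qed
  have "(\<lambda>n. l2sq M (\<lambda>x. g x - s n x)) \<longlonglongrightarrow> 0"
  proof (rule order_tendstoI)
    fix a :: ennreal assume a: "0 < a"
    \<comment> \<open>The level \<open>a\<close> may be infinite, but \<open>b\<close> is a real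
      number. The gap between them restores the strict inequality lost in the liminf.\<close>
    obtain b where b: "0 < b" "b < a" using a dense by blast
    define e where "e = enn2real b"
    have "ennreal e = b" using order.strict_trans2[OF b(2) top_greatest] by (simp add: e_def)
    with b have e: "e > 0" "ennreal e < a" by (auto simp: ennreal_less_zero_iff)
    obtain N where N: "\<And>i j. i \<ge> N \<Longrightarrow> j \<ge> N \<Longrightarrow> l2sq M (\<lambda>x. s i x - s j x) < ennreal e"
      using cau[OF e(1)] by blast
    have "l2sq M (\<lambda>x. g x - s n x) \<le> ennreal e" if n: "n \<ge> N" for n
    proof -
      have "\<forall>\<^sub>F i in sequentially. l2sq M (\<lambda>x. s (r i) x - s n x) \<le> ennreal e"
        using eventually_ge_at_top[of N]
      proof eventually_elim
        case (elim i)
        then show ?case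
          using N[OF le_trans[OF elim seq_suble[OF r]] n] by (simp add: less_imp_le)
      qed
      then have "liminf (\<lambda>i. l2sq M (\<lambda>x. s (r i) x - s n x)) \<le> ennreal e"
        by (metis Liminf_le trivial_limit_sequentially) 
      then show ?thesis using fatou[of n] by (rule order_trans[rotated])
    qed
    then show "\<forall>\<^sub>F n in sequentially. l2sq M (\<lambda>x. g x - s n x) < a"
      using e(2) by (auto simp: eventually_sequentially intro: le_less_trans)
  qed auto
  then show ?thesis by (intro bexI[of _ g]) auto
qed

section \<open>Synthesis and Gram operators of a Bessel sequence\<close>

lemma norm_ell2_power2: "(norm x)\<^sup>2 = (\<Sum>n. (cmod (coord x n))\<^sup>2)" for x :: ell2
  by (simp add: power2_norm_eq_inner inner_ell2_self)

lemma sum_coord_le_norm: "(\<Sum>n<N. (cmod (coord x n))\<^sup>2) \<le> (norm x)\<^sup>2"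
  unfolding norm_ell2_power2 by (intro sum_le_suminf summable_coord) auto

text \<open>Bessel's inequality is obtained as a bound on partial sums. This converts such a bound
  into membership in \<open>ell2\<close>, without which \<open>Abs_ell2\<close> carries no
  information.\<close>

lemma ell2_of_bounded_sums:
  assumes "\<And>N. (\<Sum>n<N. (cmod (a n))\<^sup>2) \<le> K"
  shows "coord (Abs_ell2 a) = a" and "(norm (Abs_ell2 a))\<^sup>2 \<le> K"
proof -
  have "(\<Sum>n\<le>N. (cmod (a n))\<^sup>2) \<le> K" for N
    using assms[of "Suc N"] by (simp only: lessThan_Suc_atMost)
  then have "summable (\<lambda>n. (cmod (a n))\<^sup>2)"
    by (intro bounded_imp_summable[of _ K]) auto
  then show c: "coord (Abs_ell2 a) = a" by (simp add: Abs_ell2_inverse)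
  show "(norm (Abs_ell2 a))\<^sup>2 \<le> K"
    unfolding norm_ell2_power2 c
    using suminf_le_const[OF _ assms] summable_coord[of "Abs_ell2 a"] by (simp only: c)
qed

lemma scaleR_scaleC: "r *\<^sub>R x = of_real r *\<^sub>C x" for x :: ell2
  by (simp add: coord_inject[symmetric] fun_eq_iff scaleR_ell2.rep_eq scaleC.rep_eq scaleR_conv_of_real)

text \<open>The Bessel condition is stated as a bound on finite expansions; the coefficient form
  follows by duality in \<open>coord_analysis\<close>. The pointwise bound by 1 permits pointwise
  summation of absolutely summable expansions.\<close>

locale bessel_sequence = finite_measure M for M :: "'a measure" +
  fixes \<phi> :: "nat \<Rightarrow> 'a \<Rightarrow> complex" and B :: real
  assumes B_nonneg: "0 \<le> B"
    and phi_measurable [measurable]: "\<And>n. \<phi> n \<in> borel_measurable M"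
    and phi_le_1: "\<And>n t. cmod (\<phi> n t) \<le> 1"
    and bessel: "\<And>a N. l2sq M (\<lambda>t. \<Sum>n<N. a n * \<phi> n t) \<le> ennreal (B * (\<Sum>n<N. (cmod (a n))\<^sup>2))"
begin

definition psum :: "ell2 \<Rightarrow> nat \<Rightarrow> 'a \<Rightarrow> complex" where
  "psum x N t = (\<Sum>n<N. coord x n * \<phi> n t)"

lemma psum_measurable [measurable]: "psum x N \<in> borel_measurable M"
  unfolding psum_def by measurable

lemma psum_bound: "l2sq M (psum x N) \<le> ennreal (B * (norm x)\<^sup>2)"
proof -
  have "l2sq M (psum x N) \<le> ennreal (B * (\<Sum>n<N. (cmod (coord x n))\<^sup>2))"
    using bessel[of "coord x" N] by (simp add: psum_def[abs_def])
  also have "\<dots> \<le> ennreal (B * (norm x)\<^sup>2)"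
    by (intro ennreal_leI mult_left_mono sum_coord_le_norm B_nonneg)
  finally show ?thesis .
qed

lemma psum_finite: "l2sq M (psum x N) < \<infinity>"
  using psum_bound[of x N] by (simp add: le_less_trans)

text \<open>A difference of partial sums is itself a finite expansion, with the coefficients below
  \<open>j\<close> set to 0, so \<open>bessel\<close> applies to it.\<close>

lemma psum_diff_bound:
  assumes "j \<le> i"
  shows "l2sq M (\<lambda>t. psum x i t - psum x j t) \<le> ennreal (B * (\<Sum>n=j..<i. (cmod (coord x n))\<^sup>2))"
proof -
  define a where "a n = (if n < j then 0 else coord x n)" for n
  note split = sum.atLeastLessThan_concat[OF le0 assms, symmetric, folded lessThan_atLeast0]
  have "psum x i t - psum x j t = (\<Sum>n<i. a n * \<phi> n t)" for t
    unfolding psum_def split by (simp add: a_def)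
  moreover have "(\<Sum>n<i. (cmod (a n))\<^sup>2) = (\<Sum>n=j..<i. (cmod (coord x n))\<^sup>2)"
    unfolding split by (simp add: a_def)
  ultimately show ?thesis using bessel[of a i] by simp
qed

lemma synth_exists: "\<exists>g\<in>borel_measurable M. (\<lambda>n. l2sq M (\<lambda>t. g t - psum x n t)) \<longlonglongrightarrow> 0"
proof (rule l2sq_Cauchy_convergent)
  fix e :: real assume e: "e > 0"
  \<comment> \<open>\<open>B\<close> may be 0; with \<open>B + 1\<close> the product B * (e / (B +
    1)) still stays strictly below \<open>e\<close>.\<close>
  have "e / (B + 1) > 0" using e B_nonneg by simp
  then obtain N where N: "\<And>j i. j \<ge> N \<Longrightarrow> \<bar>\<Sum>n=j..<i. (cmod (coord x n))\<^sup>2\<bar> < e / (B + 1)"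
    using summable_coord[of x] unfolding summable_Cauchy real_norm_def by blast
  have le: "l2sq M (\<lambda>t. psum x i t - psum x j t) < ennreal e" if "j \<le> i" "N \<le> j" for i j
  proof -
    have "B * (\<Sum>n=j..<i. (cmod (coord x n))\<^sup>2) \<le> B * (e / (B + 1))"
      using abs_ge_self[THEN order_le_less_trans, OF N[OF that(2), of i]] B_nonneg
      by (intro mult_left_mono) auto
    also have "\<dots> < e" using e B_nonneg by (simp add: field_simps)
    finally show ?thesis
      using psum_diff_bound[OF that(1), of x] e by (elim le_less_trans) (simp add: ennreal_lessI)
  qed
  have "l2sq M (\<lambda>t. psum x i t - psum x j t) < ennreal e" if "N \<le> i" "N \<le> j" for i j
    using le[of i j] le[of j i] that l2sq_minus_commute[of M "psum x i" "psum x j"]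
    by (cases "i \<le> j") auto
  then show "\<exists>N. \<forall>i\<ge>N. \<forall>j\<ge>N. l2sq M (\<lambda>t. psum x i t - psum x j t) < ennreal e"
    by blast
qed (use psum_finite in auto)

text \<open>\<open>SOME\<close> picks one function from an L^2 class, so identities for
  \<open>synth\<close> are claimed only almost everywhere.\<close>

definition synth :: "ell2 \<Rightarrow> 'a \<Rightarrow> complex" where
  "synth x = (SOME g. g \<in> borel_measurable M \<and> (\<lambda>n. l2sq M (\<lambda>t. g t - psum x n t)) \<longlonglongrightarrow> 0)"

lemma synth_measurable [measurable]: "synth x \<in> borel_measurable M"
  and synth_tendsto: "(\<lambda>n. l2sq M (\<lambda>t. synth x t - psum x n t)) \<longlonglongrightarrow> 0"
  using someI_ex[OF synth_exists[of x, unfolded Bex_def]] by (auto simp: synth_def)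

lemma synth_unique:
  assumes "g \<in> borel_measurable M" "(\<lambda>n. l2sq M (\<lambda>t. g t - psum x n t)) \<longlonglongrightarrow> 0"
  shows "AE t in M. synth x t = g t"
  using assms by (intro l2sq_tendsto_unique[OF _ _ _ _ synth_tendsto]) auto

text \<open>The uniform bound on partial sums passes to the limit. The 2 comes from
  \<open>l2sq_add\<close>.\<close>

lemma synth_bound: "l2sq M (synth x) \<le> ennreal (2 * B * (norm x)\<^sup>2)"
proof -
  have "l2sq M (synth x) \<le> 2 * l2sq M (\<lambda>t. synth x t - psum x n t) + ennreal (2 * B * (norm x)\<^sup>2)" for n
  proof -
    have "l2sq M (synth x) \<le> 2 * l2sq M (\<lambda>t. synth x t - psum x n t) + 2 * l2sq M (psum x n)"
      using l2sq_add[of "\<lambda>t. synth x t - psum x n t" M "psum x n"] by simp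
    also have "\<dots> \<le> 2 * l2sq M (\<lambda>t. synth x t - psum x n t) + 2 * ennreal (B * (norm x)\<^sup>2)"
      by (intro add_left_mono mult_left_mono psum_bound) auto
    also have "2 * ennreal (B * (norm x)\<^sup>2) = ennreal (2 * B * (norm x)\<^sup>2)"
      by (subst mult.assoc, subst (2) ennreal_mult) (auto simp: B_nonneg)
    finally show ?thesis .
  qed
  moreover have "(\<lambda>n. 2 * l2sq M (\<lambda>t. synth x t - psum x n t) + ennreal (2 * B * (norm x)\<^sup>2))
      \<longlonglongrightarrow> 2 * 0 + ennreal (2 * B * (norm x)\<^sup>2)"
    by (intro tendsto_add ennreal_tendsto_cmult synth_tendsto) auto
  ultimately show ?thesis
    using tendsto_lowerbound[of _ "2 * 0 + ennreal (2 * B * (norm x)\<^sup>2)" sequentially] by simp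
qed

lemma synth_finite: "l2sq M (synth x) < \<infinity>"
  using synth_bound[of x] by (simp add: le_less_trans)

lemma synth_add: "AE t in M. synth (x + y) t = synth x t + synth y t"
proof (rule synth_unique)
  have "(\<lambda>n. 2 * l2sq M (\<lambda>t. synth x t - psum x n t) + 2 * l2sq M (\<lambda>t. synth y t - psum y n t))
      \<longlonglongrightarrow> 2 * 0 + 2 * 0"
    by (intro tendsto_add ennreal_tendsto_cmult synth_tendsto) auto
  then have lim: "(\<lambda>n. 2 * l2sq M (\<lambda>t. synth x t - psum x n t)
      + 2 * l2sq M (\<lambda>t. synth y t - psum y n t)) \<longlonglongrightarrow> 0"
    by simp
  have "l2sq M (\<lambda>t. synth x t + synth y t - psum (x + y) n t)
      \<le> 2 * l2sq M (\<lambda>t. synth x t - psum x n t) + 2 * l2sq M (\<lambda>t. synth y t - psum y n t)" for n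
  proof -
    have "psum (x + y) n t = psum x n t + psum y n t" for t
      by (simp add: psum_def plus_ell2.rep_eq algebra_simps sum.distrib)
    then show ?thesis
      using l2sq_add[of "\<lambda>t. synth x t - psum x n t" M "\<lambda>t. synth y t - psum y n t"]
      by (simp add: algebra_simps)
  qed
  with lim show "(\<lambda>n. l2sq M (\<lambda>t. synth x t + synth y t - psum (x + y) n t)) \<longlonglongrightarrow> 0"
    by (rule tendsto_ennreal_0_le)
qed simp

lemma synth_scaleC: "AE t in M. synth (c *\<^sub>C x) t = c * synth x t"
proof (rule synth_unique)
  have "l2sq M (\<lambda>t. c * synth x t - psum (c *\<^sub>C x) n t)
      = ennreal ((cmod c)\<^sup>2) * l2sq M (\<lambda>t. synth x t - psum x n t)" for n
  proof -
    have "c * synth x t - psum (c *\<^sub>C x) n t = c * (synth x t - psum x n t)" for t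
      by (simp add: psum_def scaleC.rep_eq algebra_simps sum_distrib_left)
    then show ?thesis using l2sq_scale[of "\<lambda>t. synth x t - psum x n t" M c] by simp
  qed
  moreover have "(\<lambda>n. ennreal ((cmod c)\<^sup>2) * l2sq M (\<lambda>t. synth x t - psum x n t))
      \<longlonglongrightarrow> ennreal ((cmod c)\<^sup>2) * 0"
    by (intro ennreal_tendsto_cmult synth_tendsto) auto
  ultimately show "(\<lambda>n. l2sq M (\<lambda>t. c * synth x t - psum (c *\<^sub>C x) n t)) \<longlonglongrightarrow> 0" by simp
qed simp

lemma synth_diff: "AE t in M. synth (x - y) t = synth x t - synth y t"
  using synth_add[of "x - y" y] by eventually_elim simp

text \<open>Since the modes are bounded by 1, the partial sums converge uniformly, with error at
  most the tail of the absolute series. On a finite measure space this gives mean-square convergence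
  to the pointwise sum.\<close>

lemma synth_summable:
  assumes s: "summable (\<lambda>n. cmod (coord x n))"
  shows "AE t in M. synth x t = (\<Sum>n. coord x n * \<phi> n t)"
proof (rule synth_unique)
  let ?g = "\<lambda>t. \<Sum>n. coord x n * \<phi> n t"
  have le: "cmod (coord x n * \<phi> n t) \<le> cmod (coord x n)" for n t
    using phi_le_1[of n t] by (simp add: norm_mult mult_left_le)
  have sn: "summable (\<lambda>n. cmod (coord x n * \<phi> n t))" for t
    by (rule summable_comparison_test'[OF s]) (use le in auto)
  show "?g \<in> borel_measurable M" by measurable
  define \<tau> where "\<tau> N = (\<Sum>n. cmod (coord x (n + N)))" for N
  have \<tau>: "\<tau> \<longlonglongrightarrow> 0"
    unfolding \<tau>_def by (rule suminf_exist_split2[OF s])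
  have tail: "cmod (?g t - psum x N t) \<le> \<tau> N" for t N
  proof -
    have "?g t - psum x N t = (\<Sum>n. coord x (n + N) * \<phi> (n + N) t)"
      unfolding psum_def
      using suminf_split_initial_segment[OF summable_norm_cancel[OF sn[of t]], of N] by simp
    also have "cmod \<dots> \<le> \<tau> N"
      unfolding \<tau>_def
      by (intro norm_suminf_le le summable_ignore_initial_segment s)
    finally show ?thesis .
  qed
  have bd: "l2sq M (\<lambda>t. ?g t - psum x N t) \<le> ennreal ((\<tau> N)\<^sup>2) * emeasure M (space M)" for N
  proof -
    have "l2sq M (\<lambda>t. ?g t - psum x N t) \<le> (\<integral>\<^sup>+t. ennreal ((\<tau> N)\<^sup>2) \<partial>M)"
      unfolding l2sq_def using tail by (intro nn_integral_mono ennreal_leI power_mono) auto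
    then show ?thesis by simp
  qed
  have "(\<lambda>N. ennreal ((\<tau> N)\<^sup>2) * emeasure M (space M)) \<longlonglongrightarrow> ennreal (0\<^sup>2) * emeasure M (space M)"
    by (subst (1 2) mult.commute)
      (intro ennreal_tendsto_cmult tendsto_ennrealI tendsto_power \<tau>, simp add: less_top[symmetric])
  then show "(\<lambda>N. l2sq M (\<lambda>t. ?g t - psum x N t)) \<longlonglongrightarrow> 0"
    using tendsto_ennreal_0_le[OF _ bd] by simp
qed

lemma synth_basis: "AE t in M. synth (ell2_basis k) t = \<phi> k t"
proof -
  have "summable (\<lambda>n. cmod (coord (ell2_basis k) n))"
    by (rule summable_finite[of "{k}"]) (auto simp: ell2_basis.rep_eq)
  moreover have "(\<Sum>n. coord (ell2_basis k) n * \<phi> n t) = \<phi> k t" for t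
    by (subst suminf_finite[of "{k}"]) (auto simp: ell2_basis.rep_eq)
  ultimately show ?thesis using synth_summable[of "ell2_basis k"] by simp
qed

section \<open>The analysis map and the Gram operator\<close>

definition analysis :: "('a \<Rightarrow> complex) \<Rightarrow> ell2" where
  "analysis g = Abs_ell2 (\<lambda>m. \<integral>t. g t * cnj (\<phi> m t) \<partial>M)"

lemma phi_finite: "l2sq M (\<phi> n) < \<infinity>"
  using bessel[of "\<lambda>k. if k = n then 1 else 0" "Suc n"] by (simp add: le_less_trans)

text \<open>Bessel's inequality by duality: the partial sum \<open>S\<close> of the squared coefficients is the inner
  product of \<open>g\<close> with the corresponding finite expansion, which gives \<open>S\<^sup>2 \<le> G * (B * S)\<close>.\<close>

lemma coord_analysis:
  assumes [measurable]: "g \<in> borel_measurable M" and G: "l2sq M g \<le> ennreal G" "0 \<le> G"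
  shows "coord (analysis g) m = (\<integral>t. g t * cnj (\<phi> m t) \<partial>M)"
    and "(norm (analysis g))\<^sup>2 \<le> B * G"
proof -
  define c where "c m = (\<integral>t. g t * cnj (\<phi> m t) \<partial>M)" for m
  have gfin: "l2sq M g < \<infinity>" using G(1) by (simp add: le_less_trans)
  have "(\<Sum>m<N. (cmod (c m))\<^sup>2) \<le> B * G" for N
  proof -
    let ?S = "\<Sum>m<N. (cmod (c m))\<^sup>2"
    let ?f = "\<lambda>t. \<Sum>m<N. c m * \<phi> m t"
    have S0: "?S \<ge> 0" by (intro sum_nonneg) auto
    have "(\<integral>t. g t * cnj (?f t) \<partial>M) = (\<integral>t. (\<Sum>m<N. cnj (c m) * (g t * cnj (\<phi> m t))) \<partial>M)"
      by (intro Bochner_Integration.integral_cong) (auto simp: sum_distrib_left algebra_simps)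
    also have "\<dots> = (\<Sum>m<N. cnj (c m) * c m)"
      unfolding c_def using integrable_mult_cnj[OF _ _ gfin phi_finite]
      by (subst Bochner_Integration.integral_sum) auto
    also have "\<dots> = of_real ?S"
      by (simp add: complex_norm_square mult.commute flip: of_real_power)
    finally have eq: "(\<integral>t. g t * cnj (?f t) \<partial>M) = of_real ?S" .
    have "ennreal (?S\<^sup>2) \<le> l2sq M g * l2sq M ?f"
      using Cauchy_Schwarz_l2sq[of g M ?f] unfolding eq norm_of_real by simp
    also have "\<dots> \<le> ennreal G * ennreal (B * ?S)"
      by (intro mult_mono G bessel) auto
    also have "\<dots> = ennreal (G * (B * ?S))"
      using G S0 B_nonneg by (simp add: ennreal_mult)
    finally have "?S\<^sup>2 \<le> G * (B * ?S)"
      using G S0 B_nonneg by (subst (asm) ennreal_le_iff) auto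
    then have "?S * ?S \<le> (B * G) * ?S" by (simp add: power2_eq_square algebra_simps)
    then show ?thesis
      using S0 G B_nonneg by (cases "?S = 0") (auto simp: mult_le_cancel_right)
  qed
  from ell2_of_bounded_sums[of c, OF this]
  show "coord (analysis g) m = (\<integral>t. g t * cnj (\<phi> m t) \<partial>M)" "(norm (analysis g))\<^sup>2 \<le> B * G"
    by (simp_all add: analysis_def c_def[abs_def])
qed

definition gram :: "ell2 \<Rightarrow> ell2" where
  "gram x = analysis (synth x)"

lemma coord_gram: "coord (gram x) m = (\<integral>t. synth x t * cnj (\<phi> m t) \<partial>M)"
  unfolding gram_def by (rule coord_analysis[OF _ synth_bound]) (auto simp: B_nonneg)

text \<open>\<open>analysis\<close> is adjoint to \<open>synth\<close>: this is linearity of the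
  integral when \<open>y\<close> is truncated, and continuity of the L^2 inner product gives the
  general case.\<close>

lemma cinner_gram: "cinner (gram x) y = (\<integral>t. synth x t * cnj (synth y t) \<partial>M)"
proof -
  have "(\<lambda>N. \<Sum>m<N. coord (gram x) m * cnj (coord y m)) \<longlonglongrightarrow> cinner (gram x) y"
    unfolding cinner.rep_eq by (rule summable_LIMSEQ[OF summable_cinner])
  moreover have "(\<Sum>m<N. coord (gram x) m * cnj (coord y m)) = (\<integral>t. synth x t * cnj (psum y N t) \<partial>M)" for N
  proof -
    have "(\<integral>t. synth x t * cnj (psum y N t) \<partial>M)
        = (\<integral>t. (\<Sum>m<N. (synth x t * cnj (\<phi> m t)) * cnj (coord y m)) \<partial>M)"
      by (intro Bochner_Integration.integral_cong) (auto simp: psum_def sum_distrib_left algebra_simps)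
    also have "\<dots> = (\<Sum>m<N. coord (gram x) m * cnj (coord y m))"
      unfolding coord_gram using integrable_mult_cnj[OF _ _ synth_finite phi_finite]
      by (subst Bochner_Integration.integral_sum) auto
    finally show ?thesis by simp
  qed
  moreover have "(\<lambda>N. \<integral>t. synth x t * cnj (psum y N t) \<partial>M) \<longlonglongrightarrow> (\<integral>t. synth x t * cnj (synth y t) \<partial>M)"
    by (rule integral_mult_cnj_tendsto) (simp_all add: synth_tendsto synth_finite[simplified] psum_finite[simplified])
  ultimately show ?thesis by (auto intro: LIMSEQ_unique)
qed

text \<open>Integration against the modes ignores null sets, so the almost-everywhere homogeneity of
  \<open>synth\<close> becomes an exact identity in \<open>ell2\<close>. Additivity is obtained the
  same way.\<close>

lemma gram_scaleC: "gram (c *\<^sub>C x) = c *\<^sub>C gram x"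
proof -
  have "coord (gram (c *\<^sub>C x)) m = coord (c *\<^sub>C gram x) m" for m
  proof -
    have "coord (gram (c *\<^sub>C x)) m = (\<integral>t. c * (synth x t * cnj (\<phi> m t)) \<partial>M)"
      unfolding coord_gram using synth_scaleC[of c x]
      by (intro integral_cong_AE) (auto simp: mult.assoc)
    then show ?thesis by (simp add: scaleC.rep_eq coord_gram)
  qed
  then show ?thesis by (simp add: coord_inject[symmetric] fun_eq_iff)
qed

lemma gram_add: "gram (x + y) = gram x + gram y"
proof -
  have "coord (gram (x + y)) m = coord (gram x + gram y) m" for m
  proof -
    have "coord (gram (x + y)) m
        = (\<integral>t. synth x t * cnj (\<phi> m t) + synth y t * cnj (\<phi> m t) \<partial>M)"
      unfolding coord_gram using synth_add[of x y]
      by (intro integral_cong_AE) (auto simp: algebra_simps)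
    also have "\<dots> = coord (gram x + gram y) m"
      using integrable_mult_cnj[OF _ _ synth_finite phi_finite]
      by (simp add: plus_ell2.rep_eq coord_gram)
    finally show ?thesis .
  qed
  then show ?thesis by (simp add: coord_inject[symmetric] fun_eq_iff)
qed

lemma bounded_clinear_gram: "bounded_clinear gram"
proof -
  \<comment> \<open>A factor 2 * B comes from \<open>synth_bound\<close>, and a further B from
    Bessel's inequality for \<open>analysis\<close>.\<close>
  have "norm (gram x) \<le> norm x * sqrt (2 * B * B)" for x
  proof -
    have "(norm (gram x))\<^sup>2 \<le> B * (2 * B * (norm x)\<^sup>2)"
      unfolding gram_def by (rule coord_analysis[OF _ synth_bound]) (auto simp: B_nonneg)
    then have "norm (gram x) \<le> sqrt (B * (2 * B * (norm x)\<^sup>2))" by (rule real_le_rsqrt)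
    also have "\<dots> = norm x * sqrt (2 * B * B)"
      by (simp add: real_sqrt_mult algebra_simps)
    finally show ?thesis .
  qed
  then have "bounded_linear gram"
    by (intro bounded_linear_intro) (auto simp: gram_add gram_scaleC scaleR_scaleC)
  then show ?thesis by (simp add: bounded_clinear_def gram_scaleC)
qed

lemma matrix_of_gram: "matrix_of gram m n = (\<integral>t. \<phi> n t * cnj (\<phi> m t) \<partial>M)"
  unfolding matrix_of_def cinner_basis coord_gram using synth_basis[of n]
  by (intro integral_cong_AE) auto

end

section \<open>Fourier modes on the circle\<close>

text \<open>This is the conjugate of e_n. As \<open>cinner\<close> is linear in its first argument,
  the conjugate modes are the ones for which the Gram operator has entry (m, n) equal to the Fourier
  coefficient at n - m.\<close>

definition fourier_mode :: "nat \<Rightarrow> real \<Rightarrow> complex" where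
  "fourier_mode n t = exp (- (2 * of_real pi * \<i> * of_nat n * of_real t))"

lemma norm_fourier_mode [simp]: "cmod (fourier_mode n t) = 1"
  by (simp add: fourier_mode_def)

lemma fourier_mode_power: "cnj (fourier_mode n t) = exp (2 * of_real pi * \<i> * of_real t) ^ n"
  by (simp add: fourier_mode_def exp_of_nat_mult[symmetric] exp_cnj algebra_simps)

lemma fourier_mode_mult_cnj:
  "fourier_mode n t * cnj (fourier_mode m t)
    = exp (- (2 * of_real pi * \<i> * of_int (int n - int m) * of_real t))"
  by (simp add: fourier_mode_def exp_cnj exp_add[symmetric] algebra_simps)

lemma borel_measurable_unit_lebesgue:
  assumes "sets \<mu> = sets unit_lebesgue" "f \<in> borel_measurable borel"
  shows "f \<in> borel_measurable \<mu>"
  using measurable_restrict_space1[of f lborel borel "{0..<1}"] assms(2)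
  unfolding measurable_cong_sets[OF assms(1) refl] unit_lebesgue_def by simp

lemma fourier_mode_measurable:
  assumes "sets \<mu> = sets unit_lebesgue"
  shows "fourier_mode n \<in> borel_measurable \<mu>"
  by (rule borel_measurable_unit_lebesgue[OF assms])
    (unfold fourier_mode_def, intro borel_measurable_continuous_onI continuous_intros)

lemma emeasure_unit_lebesgue: "emeasure unit_lebesgue (space unit_lebesgue) = 1"
  by (simp add: unit_lebesgue_def space_restrict_space emeasure_restrict_space)

lemma finite_measure_unit_lebesgue: "finite_measure unit_lebesgue"
  by (rule finite_measureI) (simp add: emeasure_unit_lebesgue)

section \<open>Orthonormality of the modes and the Bessel bound for a bounded density\<close>

lemma integral_exp_unit_lebesgue:
  assumes k: "k \<noteq> 0"
  shows "(\<integral>t. exp (- (2 * of_real pi * \<i> * of_int k * of_real t)) \<partial>unit_lebesgue) = (0 :: complex)"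
proof -
  let ?c = "- (2 * of_real pi * \<i> * of_int k) :: complex"
  let ?f = "\<lambda>t::real. exp (?c * of_real t)"
  let ?F = "\<lambda>t::real. ?f t / ?c"
  have c: "?c \<noteq> 0" using k by simp
  have [measurable]: "?f \<in> borel_measurable borel"
    by (intro borel_measurable_continuous_onI continuous_intros)
  have "(\<integral>t. ?f t \<partial>unit_lebesgue) = (\<integral>t. indicator {0..<1} t *\<^sub>R ?f t \<partial>lborel)"
    unfolding unit_lebesgue_def by (rule integral_restrict_space) simp
  \<comment> \<open>The fundamental theorem of calculus is applied on a closed interval; the added
    endpoint is a null set.\<close>
  also have "\<dots> = (\<integral>t. indicator {0..1} t *\<^sub>R ?f t \<partial>lborel)"
  proof (rule integral_cong_AE)
    show "AE t in lborel. indicator {0..<1} t *\<^sub>R ?f t = indicator {0..1} t *\<^sub>R ?f t"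
      using AE_lborel_singleton[of "1::real"]
      by eventually_elim (auto simp: indicator_def)
  qed measurable
  also have "\<dots> = ?F 1 - ?F 0"
  proof (rule integral_FTC_Icc)
    fix t :: real
    have "((\<lambda>z. exp (?c * z) / ?c) has_field_derivative exp (?c * of_real t)) (at (of_real t))"
      using c by (auto intro!: derivative_eq_intros)
    then show "(?F has_vector_derivative ?f t) (at t within {0..1})"
      by (rule has_vector_derivative_real_field)
  qed (auto intro!: continuous_intros)
  also have "\<dots> = 0"
  proof -
    have "exp ?c = 1"
      unfolding exp_eq_1 by (auto intro!: exI[of _ "-k"])
    then show ?thesis by simp
  qed
  finally show ?thesis by simp
qed

lemma integral_fourier_mode:
  "(\<integral>t. fourier_mode n t * cnj (fourier_mode m t) \<partial>unit_lebesgue) = (if n = m then 1 else 0)"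
  unfolding fourier_mode_mult_cnj using integral_exp_unit_lebesgue[of "int n - int m"]
  by (auto simp: measure_def emeasure_unit_lebesgue)

text \<open>Parseval for finite sums: the expanded square is a double sum that orthonormality
  collapses to its diagonal. The computation is done in the complex numbers, where the orthogonality
  integrals live.\<close>

lemma l2sq_fourier_sum:
  "l2sq unit_lebesgue (\<lambda>t. \<Sum>n<N. a n * fourier_mode n t) = ennreal (\<Sum>n<N. (cmod (a n))\<^sup>2)"
proof -
  interpret finite_measure unit_lebesgue by (rule finite_measure_unit_lebesgue)
  note [measurable] = fourier_mode_measurable[OF refl]
  let ?f = "\<lambda>t. \<Sum>n<N. a n * fourier_mode n t"
  have int: "integrable unit_lebesgue (\<lambda>t. fourier_mode n t * cnj (fourier_mode m t))" for n m
    by (rule integrable_const_bound[of _ 1]) (auto simp: norm_mult)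
  have eq: "of_real ((cmod (?f t))\<^sup>2)
      = (\<Sum>n<N. \<Sum>m<N. a n * cnj (a m) * (fourier_mode n t * cnj (fourier_mode m t)))" for t
    by (simp add: complex_norm_square sum_product algebra_simps del: of_real_power)
  have intf: "integrable unit_lebesgue (\<lambda>t. complex_of_real ((cmod (?f t))\<^sup>2))"
    unfolding eq by (intro Bochner_Integration.integrable_sum integrable_mult_right int)
  have "complex_of_real (\<integral>t. (cmod (?f t))\<^sup>2 \<partial>unit_lebesgue)
      = (\<integral>t. complex_of_real ((cmod (?f t))\<^sup>2) \<partial>unit_lebesgue)"
    by (simp only: integral_complex_of_real)
  also have "\<dots> = (\<Sum>n<N. \<Sum>m<N. a n * cnj (a m) * (if n = m then 1 else 0))"
    unfolding eq
    by (simp only: Bochner_Integration.integral_sum[OF Bochner_Integration.integrable_sum[OF integrable_mult_right[OF int]]]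
       Bochner_Integration.integral_sum[OF integrable_mult_right[OF int]] integral_mult_right_zero integral_fourier_mode)
  also have "\<dots> = (\<Sum>n<N. a n * cnj (a n))"
    by (intro sum.cong) (auto simp: if_distrib cong: if_cong)
  also have "\<dots> = complex_of_real (\<Sum>n<N. (cmod (a n))\<^sup>2)"
    by (simp add: complex_norm_square del: of_real_power)
  finally have "(\<integral>t. (cmod (?f t))\<^sup>2 \<partial>unit_lebesgue) = (\<Sum>n<N. (cmod (a n))\<^sup>2)"
    by (simp only: of_real_eq_iff)
  moreover have "integrable unit_lebesgue (\<lambda>t. (cmod (?f t))\<^sup>2)"
    using intf by (simp only: complex_of_real_integrable_eq)
  ultimately show ?thesis
    unfolding l2sq_def by (subst nn_integral_eq_integral) auto
qed

text \<open>With \<open>B\<close> the essential supremum of the density, integrals of nonnegative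
  functions against \<mu> are at most \<open>B\<close> times those against Lebesgue measure. The
  constant 1 then gives finiteness, and squared moduli of finite sums give the Bessel bound by
  Parseval.\<close>

lemma bessel_sequence_fourier_mode:
  assumes sets: "sets \<mu> = sets unit_lebesgue"
    and ac: "absolutely_continuous unit_lebesgue \<mu>"
    and ess: "esssup unit_lebesgue (RN_deriv unit_lebesgue \<mu>) < \<infinity>"
  shows "\<exists>B. bessel_sequence \<mu> fourier_mode B"
proof -
  interpret L: finite_measure unit_lebesgue by (rule finite_measure_unit_lebesgue)
  define h where "h = RN_deriv unit_lebesgue \<mu>"
  define B where "B = enn2real (esssup unit_lebesgue h)"
  have B: "ennreal B = esssup unit_lebesgue h" "B \<ge> 0"
    using ess by (auto simp: B_def h_def)
  have [measurable]: "h \<in> borel_measurable unit_lebesgue" by (simp add: h_def)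
  have \<mu>: "density unit_lebesgue h = \<mu>"
    unfolding h_def by (rule L.density_RN_deriv[OF ac sets])
  have le: "(\<integral>\<^sup>+t. f t \<partial>\<mu>) \<le> ennreal B * (\<integral>\<^sup>+t. f t \<partial>unit_lebesgue)"
    if [measurable]: "f \<in> borel_measurable unit_lebesgue" for f
  proof -
    have "(\<integral>\<^sup>+t. f t \<partial>\<mu>) = (\<integral>\<^sup>+t. h t * f t \<partial>unit_lebesgue)"
      unfolding \<mu>[symmetric] by (rule nn_integral_density) auto
    also have "\<dots> \<le> (\<integral>\<^sup>+t. ennreal B * f t \<partial>unit_lebesgue)"
    proof (rule nn_integral_mono_AE)
      show "AE t in unit_lebesgue. h t * f t \<le> ennreal B * f t"
        using esssup_AE[of h unit_lebesgue] unfolding B(1)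
        by eventually_elim (rule mult_right_mono, auto)
    qed
    also have "\<dots> = ennreal B * (\<integral>\<^sup>+t. f t \<partial>unit_lebesgue)"
      by (rule nn_integral_cmult) auto
    finally show ?thesis .
  qed
  note [measurable] = fourier_mode_measurable[OF refl]
  have fin: "finite_measure \<mu>"
  proof (rule finite_measureI)
    have "space \<mu> = space unit_lebesgue" by (rule sets_eq_imp_space_eq[OF sets])
    then have "emeasure \<mu> (space \<mu>) \<le> ennreal B"
      using le[of "\<lambda>_. 1"] by (simp add: emeasure_unit_lebesgue)
    then show "emeasure \<mu> (space \<mu>) \<noteq> \<infinity>" by (auto simp: top_unique)
  qed
  have "bessel_sequence \<mu> fourier_mode B"
  proof (intro bessel_sequence.intro bessel_sequence_axioms.intro fin)
    show "l2sq \<mu> (\<lambda>t. \<Sum>n<N. a n * fourier_mode n t) \<le> ennreal (B * (\<Sum>n<N. (cmod (a n))\<^sup>2))" for a N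
      using le[of "\<lambda>t. ennreal ((cmod (\<Sum>n<N. a n * fourier_mode n t))\<^sup>2)"]
      unfolding l2sq_def[symmetric] l2sq_fourier_sum by (simp add: ennreal_mult B(2) sum_nonneg)
  qed (use B(2) fourier_mode_measurable[OF sets] in auto)
  then show ?thesis by blast
qed

section \<open>Power series with square-summable coefficients\<close>

text \<open>The coefficients are conjugated so that, on the disc, the value at z is the inner
  product of \<open>szego z\<close> with \<open>a\<close>.\<close>

definition hardy :: "ell2 \<Rightarrow> complex \<Rightarrow> complex" where
  "hardy a z = (\<Sum>n. cnj (coord a n) * z ^ n)"

text \<open>The powers of w are square-summable only for |w| < 1; elsewhere \<open>Abs_ell2\<close>
  yields an unspecified vector.\<close>

definition szego :: "complex \<Rightarrow> ell2" where
  "szego w = Abs_ell2 (\<lambda>n. w ^ n)"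

lemma coord_szego:
  assumes "cmod w < 1"
  shows "coord (szego w) n = w ^ n"
proof -
  have "(cmod w)\<^sup>2 < 1" using assms by (simp add: abs_square_less_1)
  then have "summable (\<lambda>n. (cmod (w ^ n))\<^sup>2)"
    using summable_geometric[of "(cmod w)\<^sup>2"]
    by (simp add: norm_power power_mult[symmetric] mult.commute)
  then show ?thesis by (simp add: szego_def Abs_ell2_inverse)
qed

lemma cinner_sums: "(\<lambda>n. coord x n * cnj (coord y n)) sums cinner x y"
  unfolding cinner.rep_eq by (rule summable_sums[OF summable_cinner])

lemma cinner_commute: "cinner y x = cnj (cinner x y)"
  using cinner_sums[of x y, THEN sums_cnj[THEN iffD2]] cinner_sums[of y x]
  by (auto simp: mult.commute intro: sums_unique2)

lemma hardy_sums:
  assumes "cmod z < 1"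
  shows "(\<lambda>n. cnj (coord a n) * z ^ n) sums cinner (szego z) a"
  using cinner_sums[of "szego z" a] by (simp add: coord_szego[OF assms] mult.commute)

lemma hardy_eq_cinner: "cmod z < 1 \<Longrightarrow> hardy a z = cinner (szego z) a"
  unfolding hardy_def by (rule sums_unique[OF hardy_sums, symmetric])

lemma hardy_holomorphic: "hardy a holomorphic_on ball 0 1"
  by (rule power_series_holomorphic[where a = "\<lambda>n. cnj (coord a n)"])
    (use hardy_sums hardy_eq_cinner in auto)

text \<open>A nonzero coefficient of positive index would make the sum nonvanishing on a punctured
  disc, by \<open>powser_0_nonzero\<close>. Index 0 is settled first by evaluating at 0.\<close>

lemma powser_eq_0_imp_coeff_0:
  fixes c :: "nat \<Rightarrow> complex"
  assumes s: "\<And>z. cmod z < 1 \<Longrightarrow> (\<lambda>n. c n * z ^ n) sums 0"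
  shows "c m = 0"
proof (rule ccontr)
  assume m: "c m \<noteq> 0"
  have "c 0 = 0" using s[of 0] sums_unique2[OF powser_sums_zero] by auto
  with m have "m > 0" by (cases m) auto
  show False
  proof (rule powser_0_nonzero[of 1 0 c "\<lambda>_. 0" m])
    fix r :: real assume "0 < r" "\<And>z::complex. z \<in> cball 0 r - {0} \<Longrightarrow> (0::complex) \<noteq> 0"
    from this(2)[of "of_real r"] this(1) show False by auto
  qed (use s m \<open>m > 0\<close> in auto)
qed

text \<open>\<open>cinner\<close> conjugates its second argument, so pairing with
  \<open>szego (cnj z)\<close> yields the power series in z whose coefficients are the coordinates.
  Uniqueness of coefficients concludes.\<close>

lemma szego_total:
  assumes "\<And>w. w \<in> ball 0 1 \<Longrightarrow> cinner x (szego w) = cinner y (szego w)"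
  shows "x = y"
proof -
  have "coord x m - coord y m = 0" for m
  proof (rule powser_eq_0_imp_coeff_0)
    fix z :: complex assume z: "cmod z < 1"
    have "(\<lambda>n. coord x n * z ^ n - coord y n * z ^ n) sums (cinner x (szego (cnj z)) - cinner y (szego (cnj z)))"
      using cinner_sums[of x "szego (cnj z)"] cinner_sums[of y "szego (cnj z)"] z
      by (intro sums_diff) (simp_all add: coord_szego)
    then show "(\<lambda>n. (coord x n - coord y n) * z ^ n) sums 0"
      using assms[of "cnj z"] z by (simp add: algebra_simps)
  qed
  then show ?thesis by (simp add: coord_inject[symmetric] fun_eq_iff)
qed

text \<open>Self-adjointness lets \<open>szego_total\<close> be applied in each of the two variables.\<close>

lemma self_adjoint_eqI:
  assumes S: "self_adjoint S" and T: "self_adjoint T"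
    and eq: "\<And>w z. w \<in> ball 0 1 \<Longrightarrow> z \<in> ball 0 1 \<Longrightarrow>
      cinner (S (szego z)) (szego w) = cinner (T (szego z)) (szego w)"
  shows "S = T"
proof
  fix x
  show "S x = T x"
  proof (rule szego_total)
    fix z :: complex assume "z \<in> ball 0 1"
    then have "S (szego z) = T (szego z)" by (intro szego_total eq)
    then show "cinner (S x) (szego z) = cinner (T x) (szego z)"
      using S T by (simp add: self_adjoint_def)
  qed
qed

text \<open>The inner sum over the row index m pairs the n-th column of \<open>C\<close> with
  \<open>szego w\<close>, and self-adjointness moves \<open>C\<close> onto \<open>szego w\<close>.
  The outer series agree term by term, so the identity holds for every z, even off the disc.\<close>

lemma kernel_of_matrix_eq_hardy:
  assumes "self_adjoint C" "cmod w < 1"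
  shows "kernel_of_matrix (matrix_of C) w = hardy (C (szego w))"
proof
  fix z
  have "(\<Sum>m. matrix_of C m n * cnj w ^ m * z ^ n) = cnj (coord (C (szego w)) n) * z ^ n" for n
  proof -
    have "(\<lambda>m. matrix_of C m n * cnj w ^ m) sums cinner (C (ell2_basis n)) (szego w)"
      using cinner_sums[of "C (ell2_basis n)" "szego w"] assms(2)
      by (simp add: coord_szego matrix_of_def cinner_basis)
    moreover have "cinner (C (ell2_basis n)) (szego w) = cnj (coord (C (szego w)) n)"
      using assms(1) cinner_commute[of "ell2_basis n" "C (szego w)"]
      by (simp add: self_adjoint_def cinner_basis)
    ultimately show ?thesis
      using sums_unique[OF sums_mult2] by metis
  qed
  then show "kernel_of_matrix (matrix_of C) w z = hardy (C (szego w)) z"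
    by (simp add: kernel_of_matrix_def hardy_def)
qed

text \<open>The value off \<open>\<bar>r\<bar> \<le> 1\<close> is junk that keeps the function total on \<open>ell2\<close>.\<close>

lift_definition damp :: "real \<Rightarrow> ell2 \<Rightarrow> ell2"
  is "\<lambda>r x n. if \<bar>r\<bar> \<le> 1 then of_real (r ^ n) * x n else 0"
proof -
  fix r :: real and x :: "nat \<Rightarrow> complex"
  assume x: "summable (\<lambda>n. (cmod (x n))\<^sup>2)"
  show "summable (\<lambda>n. (cmod (if \<bar>r\<bar> \<le> 1 then of_real (r ^ n) * x n else 0))\<^sup>2)"
  proof (rule summable_comparison_test'[OF x])
    fix n
    have "\<bar>r\<bar> \<le> 1 \<Longrightarrow> \<bar>r\<bar> ^ n * cmod (x n) \<le> cmod (x n)"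
      by (simp add: mult_left_le_one_le power_le_one)
    then show "norm ((cmod (if \<bar>r\<bar> \<le> 1 then of_real (r ^ n) * x n else 0))\<^sup>2) \<le> (cmod (x n))\<^sup>2"
      by (auto simp: norm_mult norm_power intro!: power_mono)
  qed
qed

text \<open>Tannery's theorem: each factor 1 - r^n tends to 0 and lies in [0,1] for 0 < r < 1, so
  the squared coordinates of \<open>a\<close> form a summable majorant.\<close>

lemma damp_tendsto: "((\<lambda>r. (norm (a - damp r a))\<^sup>2) \<longlongrightarrow> 0) (at_left 1)"
proof -
  have ev: "\<forall>\<^sub>F r::real in at_left 1. r \<in> {0<..<1}"
    by (rule eventually_at_left_real) simp
  let ?f = "\<lambda>n r. (cmod ((1 - of_real (r ^ n)) * coord a n))\<^sup>2"
  have "((\<lambda>r. \<Sum>n. ?f n r) \<longlongrightarrow> (\<Sum>n. 0)) (at_left 1)"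
  proof (rule tannerys_theorem[THEN conjunct2, THEN conjunct2])
    show "((\<lambda>r. ?f n r) \<longlongrightarrow> 0) (at_left 1)" for n
    proof -
      have "((\<lambda>r. ?f n r) \<longlongrightarrow> ?f n 1) (at_left 1)" by (intro tendsto_intros)
      then show ?thesis by simp
    qed
    \<comment> \<open>\<open>tannerys_theorem\<close> takes its majorant along a product filter;
      here the bound depends only on 0 < r < 1 and holds for all n.\<close>
    have "\<forall>\<^sub>F (n, r) in at_top \<times>\<^sub>F at_left 1. r \<in> {0<..<1::real}"
      unfolding eventually_prod_filter using ev
    by (intro exI[of _ "\<lambda>_. True"] exI[of _ "\<lambda>r. r \<in> {0<..<1}"]) auto
    then show "\<forall>\<^sub>F (n, r) in at_top \<times>\<^sub>F at_left 1. norm (?f n r) \<le> (cmod (coord a n))\<^sup>2"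
    proof eventually_elim
      case (elim p)
      obtain n r where p: "p = (n, r)" by (cases p)
      have "r ^ n \<le> 1" "0 \<le> r ^ n" using elim p by (auto simp: power_le_one)
      then have "cmod (1 - of_real (r ^ n)) \<le> 1"
        by (metis abs_of_nonneg diff_ge_0_iff_ge diff_le_eq le_add_same_cancel1 norm_of_real of_real_1 of_real_diff)
      then have "cmod ((1 - of_real (r ^ n)) * coord a n) \<le> cmod (coord a n)"
        by (simp add: norm_mult mult_left_le_one_le del: of_real_power)
      then show ?case by (simp add: p power_mono del: of_real_power)
    qed
    show "summable (\<lambda>n. (cmod (coord a n))\<^sup>2)" by (rule summable_coord)
  qed simp
  moreover have "\<forall>\<^sub>F r in at_left 1. (\<Sum>n. ?f n r) = (norm (a - damp r a))\<^sup>2"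
    using ev
  proof eventually_elim
    case (elim r)
    then show ?case
      by (simp add: norm_ell2_power2 minus_ell2.rep_eq damp.rep_eq algebra_simps)
  qed
  ultimately have "((\<lambda>r. (norm (a - damp r a))\<^sup>2) \<longlongrightarrow> (\<Sum>n. 0)) (at_left 1)"
    by (rule Lim_transform_eventually)
  then show ?thesis by simp
qed

section \<open>Boundary functions and the Gram operator\<close>

locale fourier_bessel = bessel_sequence M fourier_mode B for M B
begin

lemma hardy_radial:
  "hardy a (of_real r * exp (2 * of_real pi * \<i> * of_real t))
    = (\<Sum>n. cnj (coord a n) * (of_real (r ^ n) * cnj (fourier_mode n t)))"
  by (simp add: hardy_def fourier_mode_power power_mult_distrib)

lemma hardy_radial_measurable [measurable]:
  "(\<lambda>t. hardy a (of_real r * exp (2 * of_real pi * \<i> * of_real t))) \<in> borel_measurable M"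
  unfolding hardy_radial by measurable

text \<open>Damping makes the coefficients absolutely summable, so \<open>synth\<close> may be
  evaluated pointwise by \<open>synth_summable\<close>, and conjugation gives the radial power
  series.\<close>

lemma synth_damp:
  assumes r: "0 < r" "r < 1"
  shows "AE t in M. cnj (synth (damp r a) t) = hardy a (of_real r * exp (2 * of_real pi * \<i> * of_real t))"
proof -
  have c: "coord (damp r a) n = of_real (r ^ n) * coord a n" for n
    using r by (simp add: damp.rep_eq)
  \<comment> \<open>The damped coefficients are, in modulus, products of the square-summable
    sequences r^n and \<open>coord a\<close>.\<close>
  have "summable (\<lambda>n. cmod (coord (szego (of_real r)) n * cnj (coord a n)))"
  proof (rule summable_comparison_test'[of "\<lambda>n. (cmod (coord (szego (of_real r)) n))\<^sup>2 + (cmod (coord a n))\<^sup>2"])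
    show "norm (cmod (coord (szego (of_real r)) n * cnj (coord a n)))
        \<le> (cmod (coord (szego (of_real r)) n))\<^sup>2 + (cmod (coord a n))\<^sup>2" for n
    proof -
      have "u * v \<le> u\<^sup>2 + v\<^sup>2" if "0 \<le> u" "0 \<le> v" for u v :: real
        using sum_squares_bound[of u v] mult_nonneg_nonneg[OF that] by linarith
      then show ?thesis by (simp add: norm_mult)
    qed
  qed (intro summable_add summable_coord)
  then have s: "summable (\<lambda>n. cmod (coord (damp r a) n))"
    using r by (simp add: coord_szego c norm_mult norm_power)
  show ?thesis
    using synth_summable[OF s]
  proof eventually_elim
    case (elim t)
    have "summable (\<lambda>n. coord (damp r a) n * fourier_mode n t)"
      by (rule summable_norm_cancel) (use s in \<open>simp add: norm_mult\<close>)
    then have "(\<lambda>n. coord (damp r a) n * fourier_mode n t) sums synth (damp r a) t"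
      unfolding elim by (rule summable_sums)
    then have "(\<lambda>n. cnj (coord (damp r a) n * fourier_mode n t)) sums cnj (synth (damp r a) t)"
      by (simp only: sums_cnj)
    then show ?case
      unfolding hardy_radial by (intro sums_unique) (simp add: c mult_ac)
  qed
qed

text \<open>The radial restriction of the power series is the synthesis of the damped coefficients,
  so its mean-square distance to the synthesis of \<open>a\<close> is controlled by \<open>norm (a - damp r a)\<close>.\<close>

lemma L2_boundary_hardy: "L2_boundary M (hardy a) (\<lambda>t. cnj (synth a t))"
proof -
  let ?f = "\<lambda>r t. hardy a (of_real r * exp (2 * of_real pi * \<i> * of_real t))"
  have "((\<lambda>r. ennreal (2 * B * (norm (a - damp r a))\<^sup>2)) \<longlongrightarrow> ennreal (2 * B * 0)) (at_left 1)"
    by (intro tendsto_ennrealI tendsto_mult tendsto_const damp_tendsto)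
  then have lim: "((\<lambda>r. ennreal (2 * B * (norm (a - damp r a))\<^sup>2)) \<longlongrightarrow> 0) (at_left 1)"
    by simp
  have "\<forall>\<^sub>F r::real in at_left 1. r \<in> {0<..<1}"
    by (rule eventually_at_left_real) simp
  then have le: "\<forall>\<^sub>F r in at_left 1. l2sq M (\<lambda>t. cnj (synth a t) - ?f r t)
      \<le> ennreal (2 * B * (norm (a - damp r a))\<^sup>2)"
  proof eventually_elim
    case (elim r)
    have "l2sq M (\<lambda>t. cnj (synth a t) - ?f r t) = l2sq M (\<lambda>t. cnj (synth (a - damp r a) t))"
    proof (rule l2sq_cong_AE)
      show "AE t in M. cnj (synth a t) - ?f r t = cnj (synth (a - damp r a) t)"
        using synth_damp[of r a] synth_diff[of a "damp r a"] elim by auto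
    qed
    then show ?case using synth_bound[of "a - damp r a"] by (simp add: l2sq_cnj)
  qed
  have "((\<lambda>r. l2sq M (\<lambda>t. cnj (synth a t) - ?f r t)) \<longlongrightarrow> 0) (at_left 1)"
    using tendsto_sandwich[OF _ le tendsto_const lim] by simp
  moreover have "square_integrable M (\<lambda>t. cnj (synth a t))"
    using synth_finite[of a] by (simp add: square_integrable_iff l2sq_cnj)
  ultimately show ?thesis
    by (simp add: L2_boundary_def hardy_holomorphic l2sq_def)
qed

lemma L2_boundary_hardy_unique:
  assumes "L2_boundary M (hardy a) g"
  shows "AE t in M. g t = cnj (synth a t)"
  using assms L2_boundary_hardy[of a]
  by (intro l2sq_tendsto_unique[of "at_left (1::real)" g M "\<lambda>t. cnj (synth a t)"
        "\<lambda>r t. hardy a (of_real r * exp (2 * of_real pi * \<i> * of_real t))"])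
    (auto simp: L2_boundary_def l2sq_def square_integrable_def)

lemma self_adjoint_gram: "self_adjoint gram"
  unfolding self_adjoint_def
proof (intro allI)
  fix x y
  have "cinner x (gram y) = cnj (\<integral>t. synth y t * cnj (synth x t) \<partial>M)"
    by (simp add: cinner_commute[of x] cinner_gram)
  also have "\<dots> = (\<integral>t. cnj (synth y t * cnj (synth x t)) \<partial>M)"
    by (rule Bochner_Integration.integral_cnj[symmetric])
  finally show "cinner (gram x) y = cinner x (gram y)"
    by (simp add: cinner_gram mult.commute)
qed

lemma matrix_of_gram_fourier: "matrix_of gram = gram_matrix M"
  by (intro ext) (simp only: matrix_of_gram gram_matrix_def fourier_coeff_def fourier_mode_mult_cnj)

lemma boundary_measures_iff:
  assumes C: "self_adjoint C" and sets: "sets M = sets unit_lebesgue"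
  shows "M \<in> boundary_measures (kernel_of_matrix (matrix_of C)) \<longleftrightarrow> C = C \<circ> gram \<circ> C"
proof -
  let ?K = "kernel_of_matrix (matrix_of C)"
  define G where "G w t = cnj (synth (C (szego w)) t)" for w t
  have K: "?K w = hardy (C (szego w))" if "w \<in> ball 0 1" for w
    using kernel_of_matrix_eq_hardy[OF C, of w] that by simp
  have Kwz: "?K w z = cinner (C (szego z)) (szego w)" if "w \<in> ball 0 1" "z \<in> ball 0 1" for w z
    using that C by (simp add: K hardy_eq_cinner self_adjoint_def)
  have G: "L2_boundary M (?K w) (G w)" if "w \<in> ball 0 1" for w
    using L2_boundary_hardy[of "C (szego w)"] that by (simp add: K G_def[abs_def])
  have int: "(\<integral>t. G w t * cnj (G z t) \<partial>M) = cinner ((C \<circ> gram \<circ> C) (szego z)) (szego w)" for w z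
    using C cinner_gram[of "C (szego z)" "C (szego w)"]
    by (simp add: G_def mult.commute self_adjoint_def)
  \<comment> \<open>The existentially quantified boundary family may be replaced by
    \<open>G\<close>: boundaries are almost everywhere unique, and the integrals do not see null
    sets.\<close>
  have "M \<in> boundary_measures ?K \<longleftrightarrow> (\<forall>w\<in>ball 0 1. \<forall>z\<in>ball 0 1. ?K w z = (\<integral>t. G w t * cnj (G z t) \<partial>M))"
  proof
    assume "M \<in> boundary_measures ?K"
    then obtain Kb where b: "\<And>w. w \<in> ball 0 1 \<Longrightarrow> L2_boundary M (?K w) (Kb w)"
      and Kb: "\<And>w z. w \<in> ball 0 1 \<Longrightarrow> z \<in> ball 0 1 \<Longrightarrow> ?K w z = (\<integral>t. Kb w t * cnj (Kb z t) \<partial>M)"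
      unfolding boundary_measures_def by blast
    have ae: "AE t in M. Kb w t = G w t" if "w \<in> ball 0 1" for w
      unfolding G_def using b[OF that] unfolding K[OF that] by (rule L2_boundary_hardy_unique)
    have meas: "Kb w \<in> borel_measurable M" "G w \<in> borel_measurable M" if "w \<in> ball 0 1" for w
      using b[OF that] G[OF that] by (auto simp: L2_boundary_def square_integrable_def)
    show "\<forall>w\<in>ball 0 1. \<forall>z\<in>ball 0 1. ?K w z = (\<integral>t. G w t * cnj (G z t) \<partial>M)"
    proof (intro ballI)
      fix w z :: complex assume wz: "w \<in> ball 0 1" "z \<in> ball 0 1"
      note [measurable] = meas[OF wz(1)] meas[OF wz(2)]
      have "(\<integral>t. Kb w t * cnj (Kb z t) \<partial>M) = (\<integral>t. G w t * cnj (G z t) \<partial>M)"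
        using ae[OF wz(1)] ae[OF wz(2)] by (intro integral_cong_AE) auto
      then show "?K w z = (\<integral>t. G w t * cnj (G z t) \<partial>M)" by (simp only: Kb[OF wz])
    qed
  next
    assume "\<forall>w\<in>ball 0 1. \<forall>z\<in>ball 0 1. ?K w z = (\<integral>t. G w t * cnj (G z t) \<partial>M)"
    then show "M \<in> boundary_measures ?K"
      using G sets finite_measure_axioms unfolding boundary_measures_def by blast
  qed
  also have "\<dots> \<longleftrightarrow> C = C \<circ> gram \<circ> C"
  proof
    assume eq: "\<forall>w\<in>ball 0 1. \<forall>z\<in>ball 0 1. ?K w z = (\<integral>t. G w t * cnj (G z t) \<partial>M)"
    show "C = C \<circ> gram \<circ> C"
    proof (rule self_adjoint_eqI[OF C])
      show "self_adjoint (C \<circ> gram \<circ> C)"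
        using C self_adjoint_gram by (simp add: self_adjoint_def)
    next
      fix w z :: complex assume "w \<in> ball 0 1" "z \<in> ball 0 1"
      then show "cinner (C (szego z)) (szego w) = cinner ((C \<circ> gram \<circ> C) (szego z)) (szego w)"
        using eq Kwz int by metis
    qed
  next
    assume "C = C \<circ> gram \<circ> C"
    then have "cinner (C (szego z)) (szego w) = cinner ((C \<circ> gram \<circ> C) (szego z)) (szego w)" for w z
      by metis
    then show "\<forall>w\<in>ball 0 1. \<forall>z\<in>ball 0 1. ?K w z = (\<integral>t. G w t * cnj (G z t) \<partial>M)"
      using Kwz int by metis
  qed
  finally show ?thesis .
qed

end

text \<open>The existential does not weaken the claim: by \<open>matrix_of_inject\<close>, a bounded
  operator is determined by its matrix, so \<open>M\<close> is the operator with the Gram matrix.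
  Likewise, \<open>C = C \<circ> M \<circ> C\<close> expresses the matrix identity as one of
  operators.\<close>

theorem theorem4p1:
  fixes C :: "ell2 \<Rightarrow> ell2" and \<mu> :: "real measure"
  assumes "bounded_clinear C" and "positive_operator C" and "self_adjoint C"
    and "sets \<mu> = sets unit_lebesgue"
    and "absolutely_continuous unit_lebesgue \<mu>"
    and "esssup unit_lebesgue (RN_deriv unit_lebesgue \<mu>) < \<infinity>"
  shows "\<exists>M. bounded_clinear M \<and> matrix_of M = gram_matrix \<mu> \<and>
           (\<mu> \<in> boundary_measures (kernel_of_matrix (matrix_of C)) \<longleftrightarrow> C = C \<circ> M \<circ> C)"
proof -
  obtain B where "bessel_sequence \<mu> fourier_mode B"
    using bessel_sequence_fourier_mode assms(4-6) by blast
  then interpret fourier_bessel \<mu> B by (simp add: fourier_bessel_def)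
  show ?thesis
    using bounded_clinear_gram matrix_of_gram_fourier boundary_measures_iff[OF assms(3,4)]
    by blast
qed

end
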